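(* Let $\Gamma$ be a countable group and $(\mathfrak X,\Gamma,\Phi)$ an effective minimal equicontinuous action on a Cantor set $\mathfrak X$. Let $\mathcal U$ be an adapted neighborhood basis at a point $x\in\mathfrak X$. If the inclusion $\Upsilon_c^{\Gamma}(\Phi)\to\Upsilon_s^{\Gamma}(\Phi)$ of the direct limit countable centralizer group into the direct limit countable stabilizer group is an isomorphism, then the germinal groupoid $\mathcal G(\mathfrak X,\Gamma,\Phi)$ is Hausdorff.
   Context: A Cantor set is a compact totally disconnected metrizable space without isolated points. An action is a homomorphism $\Phi:\Gamma\to\mathrm{Homeo}(\mathfrak X)$, $g\cdot x=\Phi(g)(x)$; it is minimal if every orbit is dense, equicontinuous if the family $\{\Phi(g)\}_{g\in\Gamma}$ is equicontinuous for a compatible metric, effective if $\Phi$ is injective. A nonempty clopen set $U$ is adapted if for every $g\in\Gamma$ either $g\cdot U=U$ or $g\cdot U\cap U=\emptyset$. An adapted neighborhood basis at $x$ is a properly descending chain $\mathcal U=\{U_\ell\mid\ell\ge0\}$ of adapted clopen sets with $U_0=\mathfrak X$, $x\in U_\ell$, $\bigcap_\ell U_\ell=\{x\}$. Put $\Gamma_\ell=\{g\in\Gamma\mid g\cdot U_\ell=U_\ell\}$, $\mathcal K=\bigcap_\ell\Gamma_\ell$, $K^\Gamma_\ell=\{h\in\mathcal K\mid[h,g]\in\mathcal K\ \forall g\in\Gamma_\ell\}$, $Z^\Gamma_\ell=\{h\in\mathcal K\mid[h,g]=\mathrm{id}\ \forall g\in\Gamma_\ell\}$. Then $Z^\Gamma_\ell\subset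 K_\ell^\Gamma$ are increasing in $\ell$, and $\Upsilon^{\Gamma}_s(\Phi)=\varinjlim K^\Gamma_\ell$, $\Upsilon^{\Gamma}_c(\Phi)=\varinjlim Z^\Gamma_\ell$ with respect to the inclusion maps. Germinal groupoid: for $g\in\Gamma$, $y\in\mathfrak X$, the germ $[g]_y$ is the class of $g$ under $g_1\sim_y g_2$ iff $g_1\cdot y=g_2\cdot y$ and $g_1,g_2$ agree on an open neighborhood of $y$. $\mathcal G(\mathfrak X,\Gamma,\Phi)=\{[g]_y\}$ with the sheaf topology, with basis the sets $\{[g]_y\mid y\in U\}$, $g\in\Gamma$, $U\subset\mathfrak X$ open. *)

theory Defs
  imports "HOL-Analysis.Analysis" "HOL-Algebra.Group_Action"
begin

section \<open>Group actions on Cantor sets\<close>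

definition cantor_set :: "'x topology \<Rightarrow> bool" where
  "cantor_set X \<longleftrightarrow>
     topspace X \<noteq> {} \<and> compact_space X \<and> metrizable_space X
     \<and> (\<forall>S. connectedin X S \<longrightarrow> (\<exists>a. S \<subseteq> {a}))
     \<and> X derived_set_of (topspace X) = topspace X"

text \<open>A homomorphism into the homeomorphism group of \<open>X\<close>.  As in \<^const>\<open>BijGroup\<close>, the maps
  \<open>\<phi> g\<close> are extensional, i.e. \<^const>\<open>undefined\<close> outside \<^term>\<open>topspace X\<close>.\<close>

definition homeo_action :: "('g, 'm) monoid_scheme \<Rightarrow> 'x topology \<Rightarrow> ('g \<Rightarrow> 'x \<Rightarrow> 'x) \<Rightarrow> bool" where
  "homeo_action G X \<phi> \<longleftrightarrow>
     group_action G (topspace X) \<phi> \<and> (\<forall>g \<in> carrier G. homeomorphic_map X X (\<phi> g))"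

definition minimal_action :: "('g, 'm) monoid_scheme \<Rightarrow> 'x topology \<Rightarrow> ('g \<Rightarrow> 'x \<Rightarrow> 'x) \<Rightarrow> bool" where
  "minimal_action G X \<phi> \<longleftrightarrow> (\<forall>x \<in> topspace X. Abstract_Topology.closure_of X (orbit G \<phi> x) = topspace X)"

definition equicontinuous_action ::
    "('g, 'm) monoid_scheme \<Rightarrow> 'x topology \<Rightarrow> ('g \<Rightarrow> 'x \<Rightarrow> 'x) \<Rightarrow> bool" where
  "equicontinuous_action G X \<phi> \<longleftrightarrow>
     (\<exists>d. Metric_space (topspace X) d \<and> Metric_space.mtopology (topspace X) d = X
        \<and> (\<forall>\<epsilon>>0. \<exists>\<delta>>0. \<forall>g \<in> carrier G. \<forall>x \<in> topspace X. \<forall>y \<in> topspace X.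
              d x y < \<delta> \<longrightarrow> d (\<phi> g x) (\<phi> g y) < \<epsilon>))"

definition effective_action :: "('g, 'm) monoid_scheme \<Rightarrow> ('g \<Rightarrow> 'x \<Rightarrow> 'x) \<Rightarrow> bool" where
  "effective_action G \<phi> \<longleftrightarrow> inj_on \<phi> (carrier G)"


section \<open>Adapted sets and adapted neighborhood bases\<close>

definition adapted :: "('g, 'm) monoid_scheme \<Rightarrow> 'x topology \<Rightarrow> ('g \<Rightarrow> 'x \<Rightarrow> 'x) \<Rightarrow> 'x set \<Rightarrow> bool" where
  "adapted G X \<phi> U \<longleftrightarrow>
     U \<noteq> {} \<and> openin X U \<and> closedin X U
     \<and> (\<forall>g \<in> carrier G. \<phi> g ` U = U \<or> \<phi> g ` U \<inter> U = {})"

definition adapted_nbhd_basis ::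
    "('g, 'm) monoid_scheme \<Rightarrow> 'x topology \<Rightarrow> ('g \<Rightarrow> 'x \<Rightarrow> 'x) \<Rightarrow> 'x \<Rightarrow> (nat \<Rightarrow> 'x set) \<Rightarrow> bool" where
  "adapted_nbhd_basis G X \<phi> x U \<longleftrightarrow>
     U 0 = topspace X
     \<and> (\<forall>l. adapted G X \<phi> (U l)) \<and> (\<forall>l. U (Suc l) \<subset> U l)
     \<and> (\<forall>l. x \<in> U l) \<and> (\<Inter>l. U l) = {x}"


section \<open>Direct limits of sequences of groups\<close>

text \<open>The direct limit of the groups \<open>C n\<close> with transition maps
  \<open>f m n : C m \<rightarrow> C n\<close> for \<open>m \<le> n\<close>: the disjoint union of the \<open>C n\<close> modulo eventual equality.\<close>

definition dirlim_rel ::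
    "(nat \<Rightarrow> ('g, 'm) monoid_scheme) \<Rightarrow> (nat \<Rightarrow> nat \<Rightarrow> 'g \<Rightarrow> 'g) \<Rightarrow> ((nat \<times> 'g) \<times> (nat \<times> 'g)) set" where
  "dirlim_rel C f = {((m, a), (n, b)). a \<in> carrier (C m) \<and> b \<in> carrier (C n)
                       \<and> (\<exists>k. m \<le> k \<and> n \<le> k \<and> f m k a = f n k b)}"

definition dirlim ::
    "(nat \<Rightarrow> ('g, 'm) monoid_scheme) \<Rightarrow> (nat \<Rightarrow> nat \<Rightarrow> 'g \<Rightarrow> 'g) \<Rightarrow> (nat \<times> 'g) set monoid" where
  "dirlim C f =
     \<lparr>carrier = (SIGMA n:UNIV. carrier (C n)) // dirlim_rel C f,
      monoid.mult = (\<lambda>A B. \<Union>(m, a) \<in> A. \<Union>(n, b) \<in> B.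
         dirlim_rel C f ``
           {(max m n, f m (max m n) a \<otimes>\<^bsub>C (max m n)\<^esub> f n (max m n) b)}),
      one = dirlim_rel C f `` {(0, \<one>\<^bsub>C 0\<^esub>)}\<rparr>"

text \<open>The map of direct limits into \<open>dirlim D f\<close> induced by the levelwise maps
  \<open>u n : C n \<rightarrow> D n\<close>.\<close>

definition dirlim_map ::
    "(nat \<Rightarrow> ('g, 'm) monoid_scheme) \<Rightarrow> (nat \<Rightarrow> nat \<Rightarrow> 'g \<Rightarrow> 'g) \<Rightarrow> (nat \<Rightarrow> 'g \<Rightarrow> 'g)
     \<Rightarrow> (nat \<times> 'g) set \<Rightarrow> (nat \<times> 'g) set" where
  "dirlim_map D f u A = (\<Union>(n, a) \<in> A. dirlim_rel D f `` {(n, u n a)})"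


section \<open>The direct limit stabilizer and centralizer groups\<close>

definition commutator :: "('g, 'm) monoid_scheme \<Rightarrow> 'g \<Rightarrow> 'g \<Rightarrow> 'g" where
  "commutator G h g = h \<otimes>\<^bsub>G\<^esub> g \<otimes>\<^bsub>G\<^esub> inv\<^bsub>G\<^esub> h \<otimes>\<^bsub>G\<^esub> inv\<^bsub>G\<^esub> g"

definition level_group ::
    "('g, 'm) monoid_scheme \<Rightarrow> ('g \<Rightarrow> 'x \<Rightarrow> 'x) \<Rightarrow> (nat \<Rightarrow> 'x set) \<Rightarrow> nat \<Rightarrow> 'g set" where
  "level_group G \<phi> U l = {g \<in> carrier G. \<phi> g ` U l = U l}"

definition chain_kernel ::
    "('g, 'm) monoid_scheme \<Rightarrow> ('g \<Rightarrow> 'x \<Rightarrow> 'x) \<Rightarrow> (nat \<Rightarrow> 'x set) \<Rightarrow> 'g set" where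
  "chain_kernel G \<phi> U = (\<Inter>l. level_group G \<phi> U l)"

definition stab_level ::
    "('g, 'm) monoid_scheme \<Rightarrow> ('g \<Rightarrow> 'x \<Rightarrow> 'x) \<Rightarrow> (nat \<Rightarrow> 'x set) \<Rightarrow> nat \<Rightarrow> 'g set" where
  "stab_level G \<phi> U l =
     {h \<in> chain_kernel G \<phi> U. \<forall>g \<in> level_group G \<phi> U l. commutator G h g \<in> chain_kernel G \<phi> U}"

definition cent_level ::
    "('g, 'm) monoid_scheme \<Rightarrow> ('g \<Rightarrow> 'x \<Rightarrow> 'x) \<Rightarrow> (nat \<Rightarrow> 'x set) \<Rightarrow> nat \<Rightarrow> 'g set" where
  "cent_level G \<phi> U l =
     {h \<in> chain_kernel G \<phi> U. \<forall>g \<in> level_group G \<phi> U l. commutator G h g = \<one>\<^bsub>G\<^esub>}"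

definition Upsilon_s ::
    "('g, 'm) monoid_scheme \<Rightarrow> ('g \<Rightarrow> 'x \<Rightarrow> 'x) \<Rightarrow> (nat \<Rightarrow> 'x set) \<Rightarrow> (nat \<times> 'g) set monoid" where
  "Upsilon_s G \<phi> U = dirlim (\<lambda>l. G\<lparr>carrier := stab_level G \<phi> U l\<rparr>) (\<lambda>m n h. h)"

definition Upsilon_c ::
    "('g, 'm) monoid_scheme \<Rightarrow> ('g \<Rightarrow> 'x \<Rightarrow> 'x) \<Rightarrow> (nat \<Rightarrow> 'x set) \<Rightarrow> (nat \<times> 'g) set monoid" where
  "Upsilon_c G \<phi> U = dirlim (\<lambda>l. G\<lparr>carrier := cent_level G \<phi> U l\<rparr>) (\<lambda>m n h. h)"

text \<open>The map \<open>Upsilon_c \<rightarrow> Upsilon_s\<close> induced by the inclusions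
  \<open>cent_level G \<phi> U l \<subseteq> stab_level G \<phi> U l\<close>.\<close>

definition Upsilon_incl ::
    "('g, 'm) monoid_scheme \<Rightarrow> ('g \<Rightarrow> 'x \<Rightarrow> 'x) \<Rightarrow> (nat \<Rightarrow> 'x set)
     \<Rightarrow> (nat \<times> 'g) set \<Rightarrow> (nat \<times> 'g) set" where
  "Upsilon_incl G \<phi> U =
     dirlim_map (\<lambda>l. G\<lparr>carrier := stab_level G \<phi> U l\<rparr>) (\<lambda>m n h. h) (\<lambda>l h. h)"


section \<open>The germinal groupoid\<close>

definition germ_rel ::
    "('g, 'm) monoid_scheme \<Rightarrow> 'x topology \<Rightarrow> ('g \<Rightarrow> 'x \<Rightarrow> 'x) \<Rightarrow> 'x \<Rightarrow> ('g \<times> 'g) set" where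
  "germ_rel G X \<phi> y =
     {(g1, g2). g1 \<in> carrier G \<and> g2 \<in> carrier G \<and> \<phi> g1 y = \<phi> g2 y
        \<and> (\<exists>V. openin X V \<and> y \<in> V \<and> (\<forall>z \<in> V. \<phi> g1 z = \<phi> g2 z))}"

text \<open>The class is tagged with its base point, so that germs at distinct points are distinct.\<close>

definition germ ::
    "('g, 'm) monoid_scheme \<Rightarrow> 'x topology \<Rightarrow> ('g \<Rightarrow> 'x \<Rightarrow> 'x) \<Rightarrow> 'g \<Rightarrow> 'x \<Rightarrow> 'x \<times> 'g set" where
  "germ G X \<phi> g y = (y, germ_rel G X \<phi> y `` {g})"

definition germ_basis ::
    "('g, 'm) monoid_scheme \<Rightarrow> 'x topology \<Rightarrow> ('g \<Rightarrow> 'x \<Rightarrow> 'x) \<Rightarrow> ('x \<times> 'g set) set set" where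
  "germ_basis G X \<phi> = {germ G X \<phi> g ` V | g V. g \<in> carrier G \<and> openin X V}"

text \<open>The topological space underlying the germinal groupoid.\<close>

definition germinal_groupoid ::
    "('g, 'm) monoid_scheme \<Rightarrow> 'x topology \<Rightarrow> ('g \<Rightarrow> 'x \<Rightarrow> 'x) \<Rightarrow> ('x \<times> 'g set) topology" where
  "germinal_groupoid G X \<phi> = topology_generated_by (germ_basis G X \<phi>)"

lemma topspace_germinal_groupoid:
  "topspace (germinal_groupoid G X \<phi>) = {germ G X \<phi> g y | g y. g \<in> carrier G \<and> y \<in> topspace X}"
proof -
  have "\<Union>(germ_basis G X \<phi>) = {germ G X \<phi> g y | g y. g \<in> carrier G \<and> y \<in> topspace X}"
  proof (intro equalityI subsetI)
    fix p assume "p \<in> \<Union>(germ_basis G X \<phi>)"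
    then obtain g V y where "g \<in> carrier G" "openin X V" "y \<in> V" "p = germ G X \<phi> g y"
      by (auto simp: germ_basis_def)
    then show "p \<in> {germ G X \<phi> g y | g y. g \<in> carrier G \<and> y \<in> topspace X}"
      using openin_subset by blast
  next
    fix p assume "p \<in> {germ G X \<phi> g y | g y. g \<in> carrier G \<and> y \<in> topspace X}"
    then obtain g y where "g \<in> carrier G" "y \<in> topspace X" "p = germ G X \<phi> g y" by blast
    then have "p \<in> germ G X \<phi> g ` topspace X" "germ G X \<phi> g ` topspace X \<in> germ_basis G X \<phi>"
      by (auto simp: germ_basis_def)
    then show "p \<in> \<Union>(germ_basis G X \<phi>)" by blast
  qed
  then show ?thesis by (simp add: germinal_groupoid_def topology_generated_by_topspace)
qed

lemma germ_eq_iff: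
  assumes "g \<in> carrier G" "h \<in> carrier G"
  shows "germ G X \<phi> g y = germ G X \<phi> h z \<longleftrightarrow> y = z \<and> (y \<notin> topspace X \<or> (g, h) \<in> germ_rel G X \<phi> y)"
proof (cases "y \<in> topspace X")
  case False
  then have "germ_rel G X \<phi> y = {}" using openin_subset by (fastforce simp: germ_rel_def)
  with False show ?thesis by (auto simp: germ_def)
next
  case True
  have r: "(a, a) \<in> germ_rel G X \<phi> y" if "a \<in> carrier G" for a
    using that True by (auto simp: germ_rel_def)
  have s: "(b, a) \<in> germ_rel G X \<phi> y" if ab: "(a, b) \<in> germ_rel G X \<phi> y" for a b
  proof -
    obtain V where "openin X V" "y \<in> V" "\<forall>z \<in> V. \<phi> a z = \<phi> b z"
      using ab by (auto simp: germ_rel_def)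
    then have "\<exists>V. openin X V \<and> y \<in> V \<and> (\<forall>z \<in> V. \<phi> b z = \<phi> a z)" by metis
    then show ?thesis using ab by (auto simp: germ_rel_def)
  qed
  have t: "(a, c) \<in> germ_rel G X \<phi> y"
    if ab: "(a, b) \<in> germ_rel G X \<phi> y" and bc: "(b, c) \<in> germ_rel G X \<phi> y" for a b c
  proof -
    obtain V where V: "openin X V" "y \<in> V" "\<forall>z \<in> V. \<phi> a z = \<phi> b z"
      using ab by (auto simp: germ_rel_def)
    obtain W where W: "openin X W" "y \<in> W" "\<forall>z \<in> W. \<phi> b z = \<phi> c z"
      using bc by (auto simp: germ_rel_def)
    have "openin X (V \<inter> W)" "y \<in> V \<inter> W" "\<forall>z \<in> V \<inter> W. \<phi> a z = \<phi> c z"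
      using V W by auto
    then have "\<exists>V. openin X V \<and> y \<in> V \<and> (\<forall>z \<in> V. \<phi> a z = \<phi> c z)" by blast
    then show ?thesis using ab bc by (auto simp: germ_rel_def)
  qed
  have "germ_rel G X \<phi> y `` {g} = germ_rel G X \<phi> y `` {h} \<longleftrightarrow> (g, h) \<in> germ_rel G X \<phi> y"
  proof
    assume e: "germ_rel G X \<phi> y `` {g} = germ_rel G X \<phi> y `` {h}"
    have "h \<in> germ_rel G X \<phi> y `` {h}" using r[OF assms(2)] by blast
    then have "h \<in> germ_rel G X \<phi> y `` {g}" by (simp only: e)
    then show "(g, h) \<in> germ_rel G X \<phi> y" by blast
  next
    assume gh: "(g, h) \<in> germ_rel G X \<phi> y"
    show "germ_rel G X \<phi> y `` {g} = germ_rel G X \<phi> y `` {h}"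
      using t[OF gh] t[OF s[OF gh]] by blast
  qed
  then show ?thesis using True by (auto simp: germ_def)
qed

text \<open>The generating sets are closed under intersection, hence a basis and not just a subbasis.\<close>

lemma germ_basis_Int:
  assumes "A \<in> germ_basis G X \<phi>" "B \<in> germ_basis G X \<phi>"
  shows "A \<inter> B \<in> germ_basis G X \<phi>"
proof -
  obtain g V where A: "A = germ G X \<phi> g ` V" "g \<in> carrier G" "openin X V"
    using assms(1) by (auto simp: germ_basis_def)
  obtain h W where B: "B = germ G X \<phi> h ` W" "h \<in> carrier G" "openin X W"
    using assms(2) by (auto simp: germ_basis_def)
  let ?E = "{y \<in> V \<inter> W. (g, h) \<in> germ_rel G X \<phi> y}"
  have VX: "V \<subseteq> topspace X" using A(3) openin_subset by blast
  have "openin X ?E"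
  proof (subst openin_subopen, intro ballI)
    fix y assume y: "y \<in> ?E"
    then obtain N where N: "openin X N" "y \<in> N" "\<forall>z \<in> N. \<phi> g z = \<phi> h z"
      by (auto simp: germ_rel_def)
    have "N \<inter> (V \<inter> W) \<subseteq> ?E"
      using N A(2) B(2) unfolding germ_rel_def by blast
    moreover have "openin X (N \<inter> (V \<inter> W))" using N(1) A(3) B(3) by blast
    moreover have "y \<in> N \<inter> (V \<inter> W)" using y N(2) by blast
    ultimately show "\<exists>T. openin X T \<and> y \<in> T \<and> T \<subseteq> ?E" by blast
  qed
  moreover have "A \<inter> B = germ G X \<phi> g ` ?E"
  proof (intro equalityI subsetI)
    fix p assume "p \<in> A \<inter> B"
    then obtain y z where yz: "y \<in> V" "z \<in> W" "p = germ G X \<phi> g y" "germ G X \<phi> g y = germ G X \<phi> h z"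
      using A(1) B(1) by auto
    then have "y = z" "(g, h) \<in> germ_rel G X \<phi> y"
      using iffD1[OF germ_eq_iff[OF A(2) B(2)] yz(4)] subsetD[OF VX yz(1)] by auto
    then show "p \<in> germ G X \<phi> g ` ?E" using yz(1-3) by (intro image_eqI[of p _ y]) simp_all
  next
    fix p assume "p \<in> germ G X \<phi> g ` ?E"
    then obtain y where y: "y \<in> V" "y \<in> W" "(g, h) \<in> germ_rel G X \<phi> y" "p = germ G X \<phi> g y" by auto
    then have "germ G X \<phi> g y = germ G X \<phi> h y" by (simp add: germ_eq_iff[OF A(2) B(2)])
    then show "p \<in> A \<inter> B" using y A(1) B(1) by blast
  qed
  ultimately show ?thesis using A(2) unfolding germ_basis_def by blast
qed

end

theory Submission
  imports Defs
begin

text \<open>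
  Call \<open>h\<close> trivial near \<open>y\<close> if \<open>h\<close> fixes a neighborhood of \<open>y\<close> pointwise. Two germs
  \<open>[g\<^sub>1]\<^sub>y \<noteq> [g\<^sub>2]\<^sub>z\<close> are easily separated when \<open>y \<noteq> z\<close> or \<open>g\<^sub>1 y \<noteq> g\<^sub>2 y\<close>. Otherwise
  \<open>h = g\<^sub>1\<^sup>-\<^sup>1 g\<^sub>2\<close> fixes \<open>y\<close> and is not trivial near \<open>y\<close>, and the germs are separated as soon as
  \<open>h\<close> is not the identity on any nonempty open set. So everything reduces to this rigidity
  statement: if \<open>h\<close> is the identity on some nonempty open set \<open>O\<close> and fixes a point \<open>y\<close>, then it
  is trivial near \<open>y\<close>.

  By minimality some \<open>k\<close> moves the base point \<open>x\<close> into \<open>O\<close>, and after conjugation by \<open>k\<close> one may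
  assume \<open>x \<in> O\<close>. Compactness gives \<open>U\<^sub>l \<subseteq> O\<close> for some \<open>l\<close>, and then \<open>h\<close> lies in
  the \<open>l\<close>-th stabilizer level, because \<open>h\<close> and its commutators with elements preserving
  \<open>U\<^sub>l\<close> fix \<open>x\<close>. Since the map of direct limits is onto, \<open>h\<close> lies in
  the \<open>m\<close>-th centralizer level for some \<open>m\<close>, that is, it commutes with the group \<open>\<Gamma>\<^sub>m\<close> of all
  elements preserving \<open>U\<^sub>m\<close>. Hence \<open>h\<close> fixes the orbit \<open>\<Gamma>\<^sub>m y\<close> pointwise, and therefore also
  its closure. The closure is a neighborhood of \<open>y\<close>: by minimality and compactness finitely many
  translates of \<open>U\<^sub>m\<close> cover the space, so the full orbit of \<open>y\<close>, which is dense, is a finite union of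
  translates of \<open>\<Gamma>\<^sub>m y\<close>; by the Baire category theorem the closure of one of them has
  interior, and homogeneity carries this interior to \<open>y\<close>.
\<close>

section \<open>Groups acting by homeomorphisms\<close>

text \<open>The predicate \<^const>\<open>homeo_action\<close> as a locale.\<close>

locale homeomorphism_action = group_action G "topspace X" \<phi>
  for G (structure) and X :: "'x topology" and \<phi> +
  assumes homeo: "g \<in> carrier G \<Longrightarrow> homeomorphic_map X X (\<phi> g)"
begin

lemma is_group: "group G"
  using group_hom by (rule group_hom.axioms(1))

lemma act_closed: "g \<in> carrier G \<Longrightarrow> z \<in> topspace X \<Longrightarrow> \<phi> g z \<in> topspace X"
  using element_image by blast

lemma act_mult:
  "g \<in> carrier G \<Longrightarrow> k \<in> carrier G \<Longrightarrow> z \<in> topspace X \<Longrightarrow> \<phi> (g \<otimes> k) z = \<phi> g (\<phi> k z)"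
  by (rule composition_rule)

lemma act_one: "z \<in> topspace X \<Longrightarrow> \<phi> \<one> z = z"
  using id_eq_one by (metis restrict_apply')

lemma act_inv_act: "g \<in> carrier G \<Longrightarrow> z \<in> topspace X \<Longrightarrow> \<phi> (inv g) (\<phi> g z) = z"
  using orbit_sym_aux by blast

lemma act_act_inv: "g \<in> carrier G \<Longrightarrow> z \<in> topspace X \<Longrightarrow> \<phi> g (\<phi> (inv g) z) = z"
  using act_inv_act[of "inv g" z] group.inv_closed[OF is_group] group.inv_inv[OF is_group] by simp

lemma continuous_act: "g \<in> carrier G \<Longrightarrow> continuous_map X X (\<phi> g)"
  using homeo homeomorphic_imp_continuous_map by blast

lemma openin_vimage:
  "g \<in> carrier G \<Longrightarrow> openin X V \<Longrightarrow> openin X {z \<in> topspace X. \<phi> g z \<in> V}"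
  using continuous_act openin_continuous_map_preimage by blast

lemma openin_image: "g \<in> carrier G \<Longrightarrow> openin X V \<Longrightarrow> openin X (\<phi> g ` V)"
  using homeo homeomorphic_imp_open_map open_map_def by blast

lemma image_inv_eq:
  assumes "g \<in> carrier G" "A \<subseteq> topspace X" "\<phi> g ` A = A"
  shows "\<phi> (inv g) ` A = A"
proof -
  have "\<phi> (inv g) ` A = \<phi> (inv g) ` \<phi> g ` A" by (simp add: assms(3))
  also have "\<dots> = A"
    unfolding image_image using act_inv_act[OF assms(1)] assms(2) by (force simp: subset_iff)
  finally show ?thesis .
qed

lemma level_group_mult:
  assumes "g \<in> level_group G \<phi> U l" "k \<in> level_group G \<phi> U l" "U l \<subseteq> topspace X"
  shows "g \<otimes> k \<in> level_group G \<phi> U l"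
proof -
  have gk: "g \<in> carrier G" "k \<in> carrier G" "\<phi> g ` U l = U l" "\<phi> k ` U l = U l"
    using assms by (auto simp: level_group_def)
  have "\<phi> (g \<otimes> k) ` U l = \<phi> g ` \<phi> k ` U l"
    unfolding image_image using act_mult[OF gk(1,2)] assms(3) by (intro image_cong) auto
  then show ?thesis
    using gk monoid.m_closed[OF group.is_monoid[OF is_group]] by (simp add: level_group_def)
qed

lemma level_group_inv:
  assumes "g \<in> level_group G \<phi> U l" "U l \<subseteq> topspace X"
  shows "inv g \<in> level_group G \<phi> U l"
  using assms image_inv_eq group.inv_closed[OF is_group] by (auto simp: level_group_def)

lemma minimal_meets_open:
  assumes "minimal_action G X \<phi>" "z \<in> topspace X" "openin X V" "V \<noteq> {}"
  obtains g where "g \<in> carrier G" "\<phi> g z \<in> V"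
proof -
  obtain v where "v \<in> V" using assms(4) by blast
  moreover from this have "v \<in> Abstract_Topology.closure_of X (orbit G \<phi> z)"
    using assms openin_subset unfolding minimal_action_def by blast
  ultimately obtain w where "w \<in> orbit G \<phi> z" "w \<in> V"
    using assms(3) by (auto simp: in_closure_of)
  then show thesis using that by (auto simp: orbit_def)
qed

text \<open>The stabilizer of an adapted set has finite index, so finitely many translates of the closure
  of one of its orbits cover the space, and the closure is a neighborhood of each point of the
  orbit.\<close>

lemma closure_level_orbit_nhd:
  assumes min: "minimal_action G X \<phi>" and comp: "compact_space X" and reg: "regular_space X"
    and ad: "adapted G X \<phi> (U l)" and y: "y \<in> topspace X"
  obtains V where "openin X V" "y \<in> V"
    "V \<subseteq> Abstract_Topology.closure_of X ((\<lambda>k. \<phi> k y) ` level_group G \<phi> U l)"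
proof -
  let ?H = "level_group G \<phi> U l"
  let ?Hy = "(\<lambda>k. \<phi> k y) ` ?H"
  let ?cl = "Abstract_Topology.closure_of X"
  have A: "U l \<noteq> {}" "openin X (U l)" and
    A_ad: "\<And>g. g \<in> carrier G \<Longrightarrow> \<phi> g ` U l = U l \<or> \<phi> g ` U l \<inter> U l = {}"
    using ad by (auto simp: adapted_def)
  have AX: "U l \<subseteq> topspace X" using A(2) openin_subset by blast
  have HG: "?H \<subseteq> carrier G" by (auto simp: level_group_def)
  have HyX: "?Hy \<subseteq> topspace X" using HG act_closed y by blast
  note inv_cl = group.inv_closed[OF is_group]
  note m_cl = monoid.m_closed[OF group.is_monoid[OF is_group]]
  have "topspace X \<subseteq> \<Union>((\<lambda>g. \<phi> g ` U l) ` carrier G)"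
  proof
    fix z assume z: "z \<in> topspace X"
    obtain g where g: "g \<in> carrier G" "\<phi> g z \<in> U l"
      using minimal_meets_open[OF min z A(2,1)] .
    then have "z \<in> \<phi> (inv g) ` U l" using act_inv_act[OF g(1) z] by force
    then show "z \<in> \<Union>((\<lambda>g. \<phi> g ` U l) ` carrier G)" using inv_cl[OF g(1)] by blast
  qed
  moreover have "\<forall>T \<in> (\<lambda>g. \<phi> g ` U l) ` carrier G. openin X T"
    using openin_image A(2) by blast
  ultimately obtain \<F> where "finite \<F>" "\<F> \<subseteq> (\<lambda>g. \<phi> g ` U l) ` carrier G" "topspace X \<subseteq> \<Union>\<F>"
    using comp unfolding compact_space_alt by meson
  then obtain F where F: "finite F" "F \<subseteq> carrier G" "topspace X \<subseteq> (\<Union>g\<in>F. \<phi> g ` U l)"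
    by (metis finite_subset_image)
  \<comment> \<open>If \<open>g\<close> and \<open>c\<close> move the adapted set so that the images meet, then \<open>c\<^sup>-\<^sup>1 g\<close> stabilizes it.
    So \<open>F\<close> meets every left coset of the stabilizer.\<close>
  have orb: "orbit G \<phi> y \<subseteq> \<Union>((\<lambda>c. \<phi> c ` ?Hy) ` F)"
  proof
    fix w assume "w \<in> orbit G \<phi> y"
    then obtain g where g: "g \<in> carrier G" "w = \<phi> g y" by (auto simp: orbit_def)
    obtain a where a: "a \<in> U l" using A(1) by blast
    then have aX: "a \<in> topspace X" using AX by blast
    obtain c b where c: "c \<in> F" "b \<in> U l" "\<phi> g a = \<phi> c b"
      using F(3) act_closed[OF g(1) aX] by blast
    have cG: "c \<in> carrier G" and bX: "b \<in> topspace X" using c F(2) AX by auto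
    let ?k = "inv c \<otimes> g"
    have k: "?k \<in> carrier G" using m_cl inv_cl cG g(1) by blast
    have "\<phi> ?k a = b"
      using act_mult[OF inv_cl[OF cG] g(1) aX] c(3) act_inv_act[OF cG bX] by simp
    then have "\<phi> ?k ` U l \<inter> U l \<noteq> {}" using a c(2) by blast
    then have kH: "?k \<in> ?H" using A_ad[OF k] k by (auto simp: level_group_def)
    have "\<phi> c (\<phi> ?k y) = w"
      using act_mult[OF inv_cl[OF cG] g(1) y] act_act_inv[OF cG] act_closed[OF g(1) y] g(2)
      by simp
    then show "w \<in> \<Union>((\<lambda>c. \<phi> c ` ?Hy) ` F)" using kH c(1) by blast
  qed
  have "topspace X = ?cl (orbit G \<phi> y)" using min y by (simp add: minimal_action_def)
  also have "\<dots> \<subseteq> ?cl (\<Union>((\<lambda>c. \<phi> c ` ?Hy) ` F))" by (rule closure_of_mono[OF orb])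
  also have "\<dots> = (\<Union>c\<in>F. ?cl (\<phi> c ` ?Hy))" using F(1) by (simp add: closure_of_Union)
  finally have cover: "topspace X \<subseteq> \<Union>((\<lambda>c. ?cl (\<phi> c ` ?Hy)) ` F)" .
  have "\<exists>c \<in> F. X interior_of (?cl (\<phi> c ` ?Hy)) \<noteq> {}"
  proof (rule ccontr)
    assume "\<not> ?thesis"
    then have "X interior_of \<Union>((\<lambda>c. ?cl (\<phi> c ` ?Hy)) ` F) = {}"
      using F(1) comp reg compact_imp_locally_compact_space
      by (intro Baire_category_alt) (auto intro: countable_finite)
    moreover have "topspace X \<subseteq> X interior_of \<Union>((\<lambda>c. ?cl (\<phi> c ` ?Hy)) ` F)"
      by (rule interior_of_maximal[OF cover openin_topspace])
    ultimately show False using y by blast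
  qed
  then obtain c where c: "c \<in> F" and ne: "X interior_of (?cl (\<phi> c ` ?Hy)) \<noteq> {}" by blast
  let ?W = "X interior_of (?cl (\<phi> c ` ?Hy))"
  have cG: "c \<in> carrier G" using c F(2) by blast
  obtain w where w: "w \<in> ?W" using ne by blast
  have Wsub: "?W \<subseteq> ?cl (\<phi> c ` ?Hy)" by (rule interior_of_subset)
  then have "w \<in> ?cl (\<phi> c ` ?Hy)" using w by (rule subsetD)
  then have "\<exists>u. u \<in> \<phi> c ` ?Hy \<and> u \<in> ?W"
    using w openin_interior_of unfolding in_closure_of by blast
  then obtain k where k: "k \<in> ?H" "\<phi> c (\<phi> k y) \<in> ?W" by blast
  have kG: "k \<in> carrier G" using k HG by blast
  let ?V = "{z \<in> topspace X. \<phi> k z \<in> {z \<in> topspace X. \<phi> c z \<in> ?W}}"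
  have "openin X ?V" by (intro openin_vimage kG cG openin_interior_of)
  moreover have "y \<in> ?V" using y k act_closed[OF kG y] by simp
  moreover have "?V \<subseteq> ?cl ?Hy"
  proof
    fix z assume "z \<in> ?V"
    then have z: "z \<in> topspace X" "\<phi> k z \<in> topspace X" "\<phi> c (\<phi> k z) \<in> ?W" by auto
    then have "\<phi> c (\<phi> k z) \<in> \<phi> c ` ?cl ?Hy"
      using Wsub homeomorphic_map_closure_of[OF homeo[OF cG] HyX] by blast
    then obtain v where v: "v \<in> ?cl ?Hy" "\<phi> c (\<phi> k z) = \<phi> c v" by blast
    have vX: "v \<in> topspace X" by (rule subsetD[OF closure_of_subset_topspace v(1)])
    have "\<phi> k z = v" using act_inv_act[OF cG z(2)] act_inv_act[OF cG vX] unfolding v(2)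
      by (rule trans[OF sym])
    then have "z \<in> \<phi> (inv k) ` ?cl ?Hy" using v(1) act_inv_act[OF kG z(1)] by force
    also have "\<dots> = ?cl (\<phi> (inv k) ` ?Hy)"
      using homeomorphic_map_closure_of[OF homeo[OF inv_cl[OF kG]] HyX] by simp
    also have "\<dots> \<subseteq> ?cl ?Hy"
    proof (rule closure_of_mono, rule subsetI)
      fix u assume "u \<in> \<phi> (inv k) ` ?Hy"
      then obtain j where j: "j \<in> ?H" "u = \<phi> (inv k) (\<phi> j y)" by blast
      have ikj: "inv k \<otimes> j \<in> ?H" using level_group_mult level_group_inv k(1) j(1) AX by blast
      have "j \<in> carrier G" using j(1) HG by blast
      then have "u = \<phi> (inv k \<otimes> j) y" using act_mult[OF inv_cl[OF kG] _ y] j(2) by simp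
      then show "u \<in> ?Hy" using ikj by blast
    qed
    finally show "z \<in> ?cl ?Hy" .
  qed
  ultimately show thesis by (rule that)
qed

end

section \<open>The stabilizer and centralizer levels\<close>

lemma adapted_nbhd_basis_small:
  assumes "adapted_nbhd_basis G X \<phi> x U" "compact_space X" "openin X V" "x \<in> V"
  obtains l where "U l \<subseteq> V"
proof (rule ccontr)
  assume "\<not> thesis"
  then have ne: "U l - V \<noteq> {}" for l using that by blast
  have dec: "decseq U"
    using assms(1) by (intro decseq_SucI) (auto simp: adapted_nbhd_basis_def)
  have "closedin X (U l - V)" for l
    using assms(1,3) by (auto simp: adapted_nbhd_basis_def adapted_def intro: closedin_diff)
  moreover have "decseq (\<lambda>l. U l - V)"
    using dec unfolding decseq_def by blast
  ultimately have "(\<Inter>l. U l - V) \<noteq> {}"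
    using compact_space_imp_nest[OF assms(2), of "\<lambda>l. U l - V"] ne by blast
  moreover have "(\<Inter>l. U l) = {x}" using assms(1) by (simp add: adapted_nbhd_basis_def)
  ultimately show False using assms(4) by auto
qed

context homeomorphism_action
begin

lemma fixes_base_imp_chain_kernel:
  assumes "adapted_nbhd_basis G X \<phi> x U" "h \<in> carrier G" "\<phi> h x = x"
  shows "h \<in> chain_kernel G \<phi> U"
proof -
  have "\<phi> h ` U l = U l" for l
  proof -
    have "adapted G X \<phi> (U l)" "x \<in> U l" using assms(1) by (auto simp: adapted_nbhd_basis_def)
    moreover from this have "x \<in> \<phi> h ` U l \<inter> U l" using assms(3) by force
    ultimately show ?thesis using assms(2) unfolding adapted_def by blast
  qed
  then show ?thesis using assms(2) by (simp add: chain_kernel_def level_group_def)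
qed

text \<open>For \<open>g\<close> preserving \<open>U l\<close>, the point \<open>g\<^sup>-\<^sup>1 x\<close> lies in \<open>U l\<close> and is fixed by \<open>h\<close>, so the
  commutator of \<open>h\<close> and \<open>g\<close> fixes \<open>x\<close>.\<close>

lemma trivial_on_imp_stab_level:
  assumes bas: "adapted_nbhd_basis G X \<phi> x U" and h: "h \<in> carrier G"
    and triv: "\<And>z. z \<in> U l \<Longrightarrow> \<phi> h z = z"
  shows "h \<in> stab_level G \<phi> U l"
proof -
  have UX: "U l \<subseteq> topspace X" and xU: "x \<in> U l"
    using bas openin_subset by (auto simp: adapted_nbhd_basis_def adapted_def)
  note inv_cl = group.inv_closed[OF is_group]
  note m_cl = monoid.m_closed[OF group.is_monoid[OF is_group]]
  have "commutator G h g \<in> chain_kernel G \<phi> U" if g: "g \<in> level_group G \<phi> U l" for g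
  proof (rule fixes_base_imp_chain_kernel[OF bas])
    have gG: "g \<in> carrier G" using g by (simp add: level_group_def)
    show "commutator G h g \<in> carrier G"
      unfolding commutator_def by (intro m_cl inv_cl h gG)
    have "\<phi> (inv g) ` U l = U l"
      using level_group_inv[OF g UX] by (simp add: level_group_def)
    then have gx: "\<phi> (inv g) x \<in> U l" using xU by blast
    then have gxX: "\<phi> (inv g) x \<in> topspace X" using UX by blast
    have xX: "x \<in> topspace X" using xU UX by blast
    have "\<phi> (inv h) (\<phi> (inv g) x) = \<phi> (inv g) x"
      using act_inv_act[OF h gxX] triv[OF gx] by simp
    then show "\<phi> (commutator G h g) x = x"
      unfolding commutator_def
      using act_mult m_cl inv_cl h gG xX gxX act_act_inv[OF gG xX] triv[OF xU] by simp
  qed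
  moreover have "h \<in> chain_kernel G \<phi> U"
    using fixes_base_imp_chain_kernel[OF bas h] triv[OF xU] .
  ultimately show ?thesis by (simp add: stab_level_def)
qed

lemma cent_level_commute:
  assumes "h \<in> cent_level G \<phi> U l" "g \<in> level_group G \<phi> U l"
  shows "h \<otimes> g = g \<otimes> h"
proof -
  interpret group G by (rule is_group)
  have h: "h \<in> carrier G" and g: "g \<in> carrier G"
    using assms by (auto simp: cent_level_def chain_kernel_def level_group_def)
  have "h \<otimes> g \<otimes> inv h \<otimes> inv g = \<one>"
    using assms by (simp add: cent_level_def commutator_def)
  then show ?thesis
    using h g by (metis inv_closed inv_equality inv_inv m_closed inv_solve_right' l_one)
qed

text \<open>An element of a centralizer level fixes a closed set which, with each of its points,
  contains an orbit of the corresponding group of the chain, and this orbit is dense near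
  the point.\<close>

lemma cent_level_trivial_near_fixed_point:
  assumes min: "minimal_action G X \<phi>" and comp: "compact_space X" and Haus: "Hausdorff_space X"
    and ad: "adapted G X \<phi> (U l)" and h: "h \<in> cent_level G \<phi> U l"
    and y: "y \<in> topspace X" "\<phi> h y = y"
  obtains V where "openin X V" "y \<in> V" "\<And>z. z \<in> V \<Longrightarrow> \<phi> h z = z"
proof -
  let ?Hy = "(\<lambda>k. \<phi> k y) ` level_group G \<phi> U l"
  have hG: "h \<in> carrier G" using h by (auto simp: cent_level_def chain_kernel_def level_group_def)
  have reg: "regular_space X"
    using comp Haus by (simp add: compact_Hausdorff_imp_regular_space)
  obtain V where V: "openin X V" "y \<in> V" "V \<subseteq> Abstract_Topology.closure_of X ?Hy"
    using closure_level_orbit_nhd[where U = U and l = l, OF min comp reg ad y(1)] .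
  have "?Hy \<subseteq> {z \<in> topspace X. \<phi> h z = id z}"
  proof (clarify, intro conjI)
    fix k assume k: "k \<in> level_group G \<phi> U l"
    then have kG: "k \<in> carrier G" by (simp add: level_group_def)
    show "\<phi> k y \<in> topspace X" using act_closed[OF kG y(1)] .
    have "\<phi> h (\<phi> k y) = \<phi> (h \<otimes> k) y" using act_mult[OF hG kG y(1)] by simp
    also have "\<dots> = \<phi> k y"
      using act_mult[OF kG hG y(1)] y(2) by (simp add: cent_level_commute[OF h k])
    finally show "\<phi> h (\<phi> k y) = id (\<phi> k y)" by simp
  qed
  moreover have "closedin X {z \<in> topspace X. \<phi> h z = id z}"
    by (rule closedin_continuous_maps_eq[OF Haus continuous_act[OF hG] continuous_map_id])
  ultimately have "Abstract_Topology.closure_of X ?Hy \<subseteq> {z \<in> topspace X. \<phi> h z = id z}"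
    by (rule closure_of_minimal)
  then have "\<phi> h z = z" if "z \<in> V" for z using V(3) that by auto
  then show thesis by (rule that[OF V(1,2)])
qed

end

text \<open>All transition maps are inclusions, so an element keeps its underlying group element when it
  passes through the direct limits.\<close>

lemma Upsilon_incl_onto_imp_cent_level:
  assumes iso: "Upsilon_incl G \<phi> U \<in> iso (Upsilon_c G \<phi> U) (Upsilon_s G \<phi> U)"
    and h: "h \<in> stab_level G \<phi> U l"
  obtains m where "h \<in> cent_level G \<phi> U m"
proof -
  let ?S = "\<lambda>l. G\<lparr>carrier := stab_level G \<phi> U l\<rparr>"
  let ?f = "\<lambda>m n h. h"
  let ?p = "dirlim_rel ?S ?f `` {(l, h)}"
  have "?p \<in> carrier (Upsilon_s G \<phi> U)"
    unfolding Upsilon_s_def dirlim_def using h by (auto intro!: quotientI)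
  then have "?p \<in> Upsilon_incl G \<phi> U ` carrier (Upsilon_c G \<phi> U)"
    using iso by (simp add: iso_def bij_betw_def)
  then obtain A where A: "A \<in> carrier (Upsilon_c G \<phi> U)" "Upsilon_incl G \<phi> U A = ?p" by auto
  have "(l, h) \<in> ?p" using h by (auto simp: dirlim_rel_def)
  then obtain m b where mb: "(m, b) \<in> A" "((m, b), (l, h)) \<in> dirlim_rel ?S ?f"
    using A(2) unfolding Upsilon_incl_def dirlim_map_def by blast
  then have "b = h" by (auto simp: dirlim_rel_def)
  moreover have "b \<in> cent_level G \<phi> U m"
    using A(1) mb(1) unfolding Upsilon_c_def dirlim_def quotient_def by (auto simp: dirlim_rel_def)
  ultimately show thesis using that by blast
qed

section \<open>Rigidity and separation of germs\<close>

context homeomorphism_action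
begin

lemma trivial_on_open_imp_trivial_near_fixed_point:
  assumes min: "minimal_action G X \<phi>" and comp: "compact_space X" and Haus: "Hausdorff_space X"
    and bas: "adapted_nbhd_basis G X \<phi> x U"
    and iso: "Upsilon_incl G \<phi> U \<in> iso (Upsilon_c G \<phi> U) (Upsilon_s G \<phi> U)"
    and h: "h \<in> carrier G" and W: "openin X W" "W \<noteq> {}" "\<And>z. z \<in> W \<Longrightarrow> \<phi> h z = z"
    and y: "y \<in> topspace X" "\<phi> h y = y"
  shows "\<exists>V. openin X V \<and> y \<in> V \<and> (\<forall>z \<in> V. \<phi> h z = z)"
proof -
  interpret group G by (rule is_group)
  have ad: "adapted G X \<phi> (U l)" for l using bas by (simp add: adapted_nbhd_basis_def)
  have xX: "x \<in> topspace X" using bas by (auto simp: adapted_nbhd_basis_def)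
  obtain k where k: "k \<in> carrier G" "\<phi> k x \<in> W"
    using minimal_meets_open[OF min xX W(1,2)] .
  let ?c = "inv k \<otimes> h \<otimes> k"
  have c: "?c \<in> carrier G" using k h by simp
  have act_c: "\<phi> ?c z = \<phi> (inv k) (\<phi> h (\<phi> k z))" if "z \<in> topspace X" for z
    using that k(1) h by (simp add: act_mult act_closed)
  obtain l where l: "U l \<subseteq> {z \<in> topspace X. \<phi> k z \<in> W}"
    using adapted_nbhd_basis_small[OF bas comp openin_vimage[OF k(1) W(1)]] k(2) xX by auto
  have "\<phi> ?c z = z" if "z \<in> U l" for z
  proof -
    have "z \<in> topspace X" "\<phi> k z \<in> W" using that l by auto
    then show ?thesis using act_c W(3) act_inv_act[OF k(1)] by simp
  qed
  then have "?c \<in> stab_level G \<phi> U l" by (rule trivial_on_imp_stab_level[OF bas c])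
  then obtain m where m: "?c \<in> cent_level G \<phi> U m"
    by (rule Upsilon_incl_onto_imp_cent_level[OF iso])
  let ?y = "\<phi> (inv k) y"
  have yX: "?y \<in> topspace X" using act_closed k(1) y(1) by simp
  have "\<phi> ?c ?y = ?y" using act_c[OF yX] act_act_inv[OF k(1) y(1)] y(2) by simp
  then obtain V where V: "openin X V" "?y \<in> V" "\<And>z. z \<in> V \<Longrightarrow> \<phi> ?c z = z"
    using cent_level_trivial_near_fixed_point[OF min comp Haus ad m yX] by blast
  let ?V = "{z \<in> topspace X. \<phi> (inv k) z \<in> V}"
  have "openin X ?V" using openin_vimage k(1) V(1) by simp
  moreover have "y \<in> ?V" using y(1) V(2) by simp
  moreover have "\<phi> h z = z" if "z \<in> ?V" for z
  proof -
    have z: "z \<in> topspace X" "\<phi> (inv k) z \<in> V" using that by auto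
    have "\<phi> (inv k) (\<phi> h z) = \<phi> (inv k) z"
      using V(3)[OF z(2)] act_c[of "\<phi> (inv k) z"] act_act_inv[OF k(1) z(1)]
        act_closed[of "inv k" z] k(1) z(1) by simp
    then show ?thesis
      using act_act_inv[OF k(1) z(1)] act_act_inv[OF k(1) act_closed[OF h z(1)]] by simp
  qed
  ultimately show ?thesis by blast
qed

text \<open>If two germs at the same point with the same target are distinct, then by rigidity the two
  group elements agree on no nonempty open set, so they have no germ in common at all and
  the whole space serves as both neighborhoods.\<close>

lemma Hausdorff_germinal_groupoid:
  assumes Haus: "Hausdorff_space X"
    and rigid: "\<And>h W y. \<lbrakk>h \<in> carrier G; openin X W; W \<noteq> {}; \<And>z. z \<in> W \<Longrightarrow> \<phi> h z = z;
        y \<in> topspace X; \<phi> h y = y\<rbrakk> \<Longrightarrow> \<exists>V. openin X V \<and> y \<in> V \<and> (\<forall>z \<in> V. \<phi> h z = z)"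
  shows "Hausdorff_space (germinal_groupoid G X \<phi>)"
  unfolding Hausdorff_space_def
proof (intro allI impI, elim conjE)
  interpret group G by (rule is_group)
  let ?T = "germinal_groupoid G X \<phi>"
  fix p q assume p: "p \<in> topspace ?T" and q: "q \<in> topspace ?T" and "p \<noteq> q"
  obtain a y where a: "a \<in> carrier G" "y \<in> topspace X" "p = germ G X \<phi> a y"
    using p by (auto simp: topspace_germinal_groupoid)
  obtain b z where b: "b \<in> carrier G" "z \<in> topspace X" "q = germ G X \<phi> b z"
    using q by (auto simp: topspace_germinal_groupoid)
  have op: "openin ?T (germ G X \<phi> g ` V)" if "g \<in> carrier G" "openin X V" for g V
    using that unfolding germinal_groupoid_def
    by (intro topology_generated_by_Basis) (auto simp: germ_basis_def)
  have "\<exists>V W. openin X V \<and> openin X W \<and> y \<in> V \<and> z \<in> W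
      \<and> (\<forall>v \<in> V. \<forall>w \<in> W. germ G X \<phi> a v \<noteq> germ G X \<phi> b w)"
  proof (cases "y = z")
    case False
    then obtain V W where "openin X V" "openin X W" "y \<in> V" "z \<in> W" "disjnt V W"
      using Haus a(2) b(2) unfolding Hausdorff_space_def by blast
    moreover from this have "\<forall>v \<in> V. \<forall>w \<in> W. germ G X \<phi> a v \<noteq> germ G X \<phi> b w"
      by (auto simp: germ_def disjnt_def)
    ultimately show ?thesis by blast
  next
    case yz: True
    show ?thesis
    proof (cases "\<phi> a y = \<phi> b y")
      case False
      then obtain V W where VW: "openin X V" "openin X W" "\<phi> a y \<in> V" "\<phi> b y \<in> W" "disjnt V W"
        using Haus act_closed[OF a(1,2)] act_closed[OF b(1) a(2)]
        unfolding Hausdorff_space_def by blast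
      let ?V = "{v \<in> topspace X. \<phi> a v \<in> V}" and ?W = "{v \<in> topspace X. \<phi> b v \<in> W}"
      have "germ G X \<phi> a v \<noteq> germ G X \<phi> b w" if "v \<in> ?V" "w \<in> ?W" for v w
        using that VW(5) by (auto simp: germ_eq_iff[OF a(1) b(1)] germ_rel_def disjnt_def)
      then show ?thesis
        using openin_vimage[OF a(1) VW(1)] openin_vimage[OF b(1) VW(2)] VW(3,4) a(2) yz by blast
    next
      case True
      let ?h = "inv a \<otimes> b"
      have hG: "?h \<in> carrier G" using a(1) b(1) by simp
      have h_iff: "\<phi> ?h v = v \<longleftrightarrow> \<phi> a v = \<phi> b v" if v: "v \<in> topspace X" for v
        using act_mult[OF inv_closed[OF a(1)] b(1) v] act_inv_act[OF a(1) v]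
          act_act_inv[OF a(1) act_closed[OF b(1) v]] by metis
      have "germ G X \<phi> a v \<noteq> germ G X \<phi> b w" if v: "v \<in> topspace X" for v w
      proof
        assume "germ G X \<phi> a v = germ G X \<phi> b w"
        then have "(a, b) \<in> germ_rel G X \<phi> v"
          using v by (auto simp: germ_eq_iff[OF a(1) b(1)])
        then obtain N where N: "openin X N" "v \<in> N" "\<And>u. u \<in> N \<Longrightarrow> \<phi> a u = \<phi> b u"
          by (auto simp: germ_rel_def)
        have "\<And>u. u \<in> N \<Longrightarrow> \<phi> ?h u = u" using N(1,3) h_iff openin_subset by blast
        then obtain V where V: "openin X V" "y \<in> V" "\<forall>u \<in> V. \<phi> ?h u = u"
          using rigid[OF hG N(1), of y] N(2) a(2) h_iff True by blast
        then have "\<forall>u \<in> V. \<phi> a u = \<phi> b u" using h_iff openin_subset by blast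
        then have "(a, b) \<in> germ_rel G X \<phi> y"
          using V(1,2) a(1) b(1) True by (auto simp: germ_rel_def)
        then have "p = q" using a(3) b(3) yz by (simp add: germ_eq_iff[OF a(1) b(1)])
        then show False using \<open>p \<noteq> q\<close> by contradiction
      qed
      then show ?thesis using a(2) b(2) by blast
    qed
  qed
  then obtain V W where VW: "openin X V" "openin X W" "y \<in> V" "z \<in> W"
      "\<forall>v \<in> V. \<forall>w \<in> W. germ G X \<phi> a v \<noteq> germ G X \<phi> b w"
    by blast
  have "disjnt (germ G X \<phi> a ` V) (germ G X \<phi> b ` W)" using VW(5) unfolding disjnt_def by blast
  moreover have "p \<in> germ G X \<phi> a ` V" "q \<in> germ G X \<phi> b ` W" using VW(3,4) a(3) b(3) by auto
  ultimately show "\<exists>P Q. openin ?T P \<and> openin ?T Q \<and> p \<in> P \<and> q \<in> Q \<and> disjnt P Q"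
    using op[OF a(1) VW(1)] op[OF b(1) VW(2)] by blast
qed

end

theorem mainTheorem6:
  fixes G :: "('g, 'm) monoid_scheme" and X :: "'x topology"
    and \<phi> :: "'g \<Rightarrow> 'x \<Rightarrow> 'x" and x :: 'x and U :: "nat \<Rightarrow> 'x set"
  assumes "group G" and "countable (carrier G)"
    and "cantor_set X"
    and "homeo_action G X \<phi>"
    and "effective_action G \<phi>"
    and "minimal_action G X \<phi>"
    and "equicontinuous_action G X \<phi>"
    and "x \<in> topspace X"
    and "adapted_nbhd_basis G X \<phi> x U"
    and "Upsilon_incl G \<phi> U \<in> iso (Upsilon_c G \<phi> U) (Upsilon_s G \<phi> U)"
  shows "Hausdorff_space (germinal_groupoid G X \<phi>)"
proof -
  interpret homeomorphism_action G X \<phi>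
    using assms(4)
    by (simp add: homeo_action_def homeomorphism_action_def homeomorphism_action_axioms_def)
  have comp: "compact_space X" and Haus: "Hausdorff_space X"
    using assms(3) metrizable_imp_Hausdorff_space unfolding cantor_set_def by blast+
  show ?thesis
  proof (rule Hausdorff_germinal_groupoid[OF Haus])
    fix h W y
    assume h: "h \<in> carrier G" and W: "openin X W" "W \<noteq> {}" "\<And>z. z \<in> W \<Longrightarrow> \<phi> h z = z"
      and y: "y \<in> topspace X" "\<phi> h y = y"
    show "\<exists>V. openin X V \<and> y \<in> V \<and> (\<forall>z \<in> V. \<phi> h z = z)"
      by (rule trivial_on_open_imp_trivial_near_fixed_point
          [OF assms(6) comp Haus assms(9,10) h W y])
  qed
qed

end
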